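(* Let $n$ and $k$ be integers with $k\ge3$ and \[ n\ge\frac{\log_2(1+\sqrt{21})}{3}\,(13k-6). \] Then $F_{\mathrm{inv}}$ over $\mathbb F_{2^n}$ is not $k$th order sum-free.
   Context: $F_{\mathrm{inv}}:\mathbb F_{2^n}\to\mathbb F_{2^n}$ is defined by $F_{\mathrm{inv}}(x)=x^{2^n-2}$ (so $F_{\mathrm{inv}}(x)=x^{-1}$ for $x\ne0$ and $F_{\mathrm{inv}}(0)=0$). For an integer $1\le k\le n-1$, a function $F:\mathbb F_{2^n}\to\mathbb F_{2^n}$ is called $k$th order sum-free if $\sum_{x\in A}F(x)\ne 0$ for every $k$-dimensional affine $\mathbb F_2$-subspace $A$ of $\mathbb F_{2^n}$. *)

theory Defs
  imports
    Complex_Main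
    "HOL-Library.Z2"
    "HOL-Library.Cardinality"
    "HOL-Computational_Algebra.Primes"
begin

text \<open>
  The field with \<open>2^n\<close> elements is rendered as a type \<open>'a :: finite_field\<close> with \<open>CARD('a) = 2 ^ n\<close>.
  The prime field is the library type \<^typ>\<open>bit\<close>, acting through \<open>of_bit\<close>
  (which sends \<open>0\<close> to \<open>0\<close> and \<open>1\<close> to \<open>1\<close>); this action
  is a vector space structure because the characteristic is 2.
\<close>

definition F2_scale :: "bit \<Rightarrow> 'a::finite_field \<Rightarrow> 'a" where
  "F2_scale c x = of_bit c * x"

lemma one_plus_one_eq_0:
  assumes "CARD('a::finite_field) = 2 ^ n"
  shows "(1 :: 'a) + 1 = 0"
proof -
  have "card {0, 1 :: 'a} \<le> CARD('a)"
    by (rule card_mono) simp_all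
  then have "n \<noteq> 0"
    using assms by (intro notI) simp
  then have "(-1 :: 'a) ^ CARD('a) = 1"
    using assms by simp
  then have "(1 :: 'a) = -1"
    using finite_field_power_card_eq_same[of "-1 :: 'a"] by simp
  then show ?thesis
    by (metis add.right_inverse)
qed

lemma vector_space_F2_scale:
  assumes "CARD('a::finite_field) = 2 ^ n"
  shows "vector_space (F2_scale :: bit \<Rightarrow> 'a \<Rightarrow> 'a)"
proof -
  have two: "x + x = 0" for x :: 'a
    using one_plus_one_eq_0[OF assms] by (metis distrib_left mult.right_neutral mult_zero_right)
  show ?thesis
  proof
    fix a b :: bit and x y :: 'a
    show "F2_scale a (x + y) = F2_scale a x + F2_scale a y"
      by (simp add: F2_scale_def algebra_simps)
    show "F2_scale (a + b) x = F2_scale a x + F2_scale b x"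
      by (cases a; cases b) (simp_all add: F2_scale_def two)
    show "F2_scale a (F2_scale b x) = F2_scale (a * b) x"
      by (cases a; cases b) (simp_all add: F2_scale_def)
    show "F2_scale 1 x = x"
      by (simp add: F2_scale_def)
  qed
qed

definition F2_affine_subspace :: "nat \<Rightarrow> 'a::finite_field set \<Rightarrow> bool" where
  "F2_affine_subspace k A \<longleftrightarrow>
     (\<exists>a V. module.subspace F2_scale V \<and> vector_space.dim F2_scale V = k \<and> A = (+) a ` V)"

text \<open>
  The notion is only used for \<open>1 \<le> k \<le> n - 1\<close>. This range is not part of the predicate,
  so that \<open>\<not> sum_free k F\<close> always means that some \<open>k\<close>-dimensional affine subspace has sum zero.
\<close>

definition sum_free :: "nat \<Rightarrow> ('a::finite_field \<Rightarrow> 'a) \<Rightarrow> bool" where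
  "sum_free k F \<longleftrightarrow> (\<forall>A. F2_affine_subspace k A \<longrightarrow> (\<Sum>x\<in>A. F x) \<noteq> 0)"

definition F_inv :: "nat \<Rightarrow> 'a::finite_field \<Rightarrow> 'a" where
  "F_inv n x = x ^ (2 ^ n - 2)"

end

theory Submission
  imports Defs "HOL-Computational_Algebra.Polynomial"
begin

text \<open>
  Call \<open>L(x) = \<Sum>i\<le>k. b i * x^(2^i)\<close>, monic of degree \<open>2^k\<close>, split if its kernel has \<open>2^k\<close>
  elements. The adjoint of \<open>L\<close> for the trace form then has a kernel \<open>V\<close> of the same size, and the
  elements of \<open>V\<close> are the roots of \<open>y + \<Sum>j\<ge>1. c j * y^(2^j)\<close> with \<open>c j = b (k - j)^(2^j)\<close>.
  If \<open>b (k - 1) = 0\<close>, dividing by \<open>y^2\<close> expresses \<open>1/y\<close> on \<open>V\<close> through the monomials \<open>y^(2^j - 2)\<close>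
  with \<open>2 \<le> j \<le> k\<close>; their exponents have fewer than \<open>k\<close> binary digits \<open>1\<close>, so their sums
  over the \<open>k\<close>-dimensional space \<open>V\<close> vanish.

  Such an \<open>L\<close> arises from a split \<open>M\<close> of degree \<open>2^(k - 2)\<close> with second coefficient \<open>b \<noteq> 0\<close> by enlarging
  the kernel to \<open>M -` {0, X, Y, X + Y}\<close> for two values \<open>X\<close>, \<open>Y\<close> of \<open>M\<close>: the second coefficient becomes
  \<open>b^4 + X^2 + X * Y + Y^2\<close>. So one needs a point of the conic \<open>X^2 + X * Y + Y^2 = b^4\<close> with
  both coordinates in the image of \<open>M\<close>, a subgroup of index \<open>2^(k - 2)\<close>. Counting with
  additive characters reduces this to a bound for Kloosterman sums, for which Kloosterman's elementary
  fourth moment estimate \<open>K^4 \<le> 3 * q^3\<close> suffices once \<open>n \<ge> 8 * k - 4\<close>.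
\<close>

section \<open>Trace, additive character, Kloosterman sums and linearized polynomials\<close>

definition trace2 :: "nat \<Rightarrow> 'a::finite_field \<Rightarrow> 'a" where
  "trace2 n x = (\<Sum>i<n. x ^ (2 ^ i))"

text \<open>The additive character \<open>(-1)^Tr(x)\<close>, real-valued so that its sums can be
  bounded by inequalities.\<close>

definition chi :: "nat \<Rightarrow> 'a::finite_field \<Rightarrow> real" where
  "chi n x = (if trace2 n x = 0 then 1 else -1)"

definition kloosterman :: "nat \<Rightarrow> 'a::finite_field \<Rightarrow> 'a \<Rightarrow> real" where
  "kloosterman n a b = (\<Sum>x\<in>UNIV - {0}. chi n (a * x + b / x))"

text \<open>These are the additive subgroups: in characteristic 2 every element is its own
  negative.\<close>

definition add_closed :: "'a::finite_field set \<Rightarrow> bool" where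
  "add_closed S \<longleftrightarrow> 0 \<in> S \<and> (\<forall>x\<in>S. \<forall>y\<in>S. x + y \<in> S)"

definition lin_poly :: "(nat \<Rightarrow> 'a::finite_field) \<Rightarrow> nat \<Rightarrow> 'a \<Rightarrow> 'a" where
  "lin_poly b m x = (\<Sum>i\<le>m. b i * x ^ (2 ^ i))"

text \<open>Splitting is expressed by the size of the kernel. The zeros above \<open>m\<close> make
  \<open>extend_coeffs\<close> yield again a monic sequence, of leading index
  \<open>Suc m\<close>.\<close>

definition splits_with_degree :: "(nat \<Rightarrow> 'a::finite_field) \<Rightarrow> nat \<Rightarrow> bool" where
  "splits_with_degree b m \<longleftrightarrow>
     b m = 1 \<and> (\<forall>i>m. b i = 0) \<and> card {x. lin_poly b m x = 0} = 2 ^ m"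

text \<open>
  The coefficients of \<open>L^2 + X * L\<close>, whose kernel is \<open>L -` {0, X}\<close>.
\<close>

definition extend_coeffs :: "'a::finite_field \<Rightarrow> (nat \<Rightarrow> 'a) \<Rightarrow> nat \<Rightarrow> 'a" where
  "extend_coeffs X b i = (case i of 0 \<Rightarrow> 0 | Suc j \<Rightarrow> (b j)\<^sup>2) + X * b i"

context
  fixes n :: nat
  assumes card: "CARD('a::finite_field) = 2 ^ n"
begin

section \<open>Characteristic 2 and powers of Frobenius\<close>

lemma add_self: "(x :: 'a) + x = 0"
  using one_plus_one_eq_0[OF card] by (metis distrib_left mult.right_neutral mult_zero_right)

lemma minus_eq: "- (x :: 'a) = x"
  using minus_unique[OF add_self[of x]] .

lemma add_eq_0: "(x :: 'a) + y = 0 \<longleftrightarrow> x = y"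
  by (metis minus_eq eq_neg_iff_add_eq_0)

lemma n_pos: "n > 0"
proof (rule ccontr)
  assume "\<not> n > 0"
  then have "CARD('a) = 1" using card by simp
  moreover have "card {0, 1 :: 'a} \<le> CARD('a)" by (rule card_mono) simp_all
  ultimately show False by simp
qed

lemma square_add: "((x :: 'a) + y)\<^sup>2 = x\<^sup>2 + y\<^sup>2"
proof -
  have "(x + y)\<^sup>2 = x\<^sup>2 + y\<^sup>2 + (x * y + x * y)" by (simp add: power2_eq_square algebra_simps)
  then show ?thesis using add_self[of "x * y"] by simp
qed

lemma frob_add: "((x :: 'a) + y) ^ (2 ^ i) = x ^ (2 ^ i) + y ^ (2 ^ i)"
proof (induction i arbitrary: x y)
  case (Suc i)
  have "(x + y) ^ (2 ^ Suc i) = ((x + y)\<^sup>2) ^ (2 ^ i)" by (simp flip: power_mult)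
  also have "\<dots> = x ^ (2 ^ Suc i) + y ^ (2 ^ Suc i)"
    by (simp add: square_add Suc.IH flip: power_mult)
  finally show ?case .
qed simp

lemma frob_sum: "(\<Sum>j\<in>J. f j :: 'a) ^ (2 ^ i) = (\<Sum>j\<in>J. f j ^ (2 ^ i))"
  by (induction J rule: infinite_finite_induct) (simp_all add: frob_add)

lemma frob_n: "(x :: 'a) ^ (2 ^ n) = x"
  using finite_field_power_card_eq_same[of x] card by simp

lemma bij_frob: "bij (\<lambda>x :: 'a. x ^ (2 ^ i))"
proof -
  have "inj (\<lambda>x :: 'a. x ^ (2 ^ i))"
  proof (rule injI)
    fix x y :: 'a assume "x ^ (2 ^ i) = y ^ (2 ^ i)"
    then have "(x + y) ^ (2 ^ i) = 0" by (simp add: frob_add add_self)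
    then show "x = y" by (simp add: add_eq_0)
  qed
  then show ?thesis by (simp add: bij_def finite_UNIV_inj_surj)
qed

lemma bij_square: "bij (\<lambda>x :: 'a. x\<^sup>2)"
  using bij_frob[of 1] by simp

section \<open>The absolute trace and its character\<close>

lemma trace2_add: "trace2 n (x + y :: 'a) = trace2 n x + trace2 n y"
  by (simp add: trace2_def frob_add sum.distrib)

lemma trace2_square: "trace2 n ((x :: 'a)\<^sup>2) = trace2 n x"
proof -
  have "trace2 n (x\<^sup>2) + x = (\<Sum>i<Suc n. x ^ (2 ^ i))"
    unfolding sum.lessThan_Suc_shift by (simp add: trace2_def add.commute flip: power_mult)
  also have "\<dots> = trace2 n x + x"
    by (simp add: trace2_def frob_n)
  finally show ?thesis by simp
qed

text \<open>The trace is fixed by squaring, hence a root of \<open>t^2 - t\<close>.\<close>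

lemma trace2_cases: "trace2 n (x :: 'a) = 0 \<or> trace2 n x = 1"
proof -
  have "(trace2 n x)\<^sup>2 = trace2 n (x\<^sup>2)"
    unfolding trace2_def using frob_sum[of "\<lambda>i. x ^ (2 ^ i)" "{..<n}" 1]
    by (simp add: mult.commute flip: power_mult)
  then have "trace2 n x * (trace2 n x - 1) = 0"
    unfolding trace2_square by (simp add: power2_eq_square right_diff_distrib)
  then show ?thesis by auto
qed

text \<open>The trace is a nonzero polynomial of degree at most \<open>2^(n - 1)\<close>, too small
  to vanish at all \<open>2^n\<close> elements.\<close>

lemma trace2_surj: "\<exists>z :: 'a. trace2 n z \<noteq> 0"
proof (rule ccontr)
  assume "\<nexists>z :: 'a. trace2 n z \<noteq> 0"
  then have all: "trace2 n z = 0" for z :: 'a by auto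
  define p :: "'a poly" where "p = (\<Sum>i<n. monom 1 (2 ^ i))"
  have "coeff p 1 = (\<Sum>i<n. if i = 0 then 1 else 0)"
    unfolding p_def coeff_sum by (intro sum.cong) auto
  also have "\<dots> = 1" using n_pos by simp
  finally have "p \<noteq> 0" by auto
  have "degree p \<le> 2 ^ (n - 1)"
    unfolding p_def by (intro degree_sum_le) (auto simp: degree_monom_eq)
  moreover have "card {x. poly p x = 0} \<le> degree p"
    by (rule card_poly_roots_bound) fact
  moreover have "{x. poly p x = 0} = UNIV"
    using all by (auto simp: p_def poly_sum poly_monom trace2_def)
  ultimately have "(2::nat) ^ n \<le> 2 ^ (n - 1)" using card by (metis order.trans)
  then show False using n_pos by (simp add: power_increasing_iff)
qed

lemma chi_0 [simp]: "chi n (0 :: 'a) = 1"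
  by (simp add: chi_def trace2_def power_0_left)

lemma chi_add: "chi n (x + y :: 'a) = chi n x * chi n y"
  using trace2_cases[of x] trace2_cases[of y] add_self[of 1]
  by (auto simp: chi_def trace2_add)

lemma chi_frob: "chi n ((x :: 'a) ^ (2 ^ i)) = chi n x"
proof (induction i arbitrary: x)
  case (Suc i)
  have "x ^ (2 ^ Suc i) = (x\<^sup>2) ^ (2 ^ i)" by (simp flip: power_mult)
  then show ?case by (simp only: Suc.IH) (simp add: chi_def trace2_square)
qed simp

lemma chi_square: "chi n ((x :: 'a)\<^sup>2) = chi n x"
  using chi_frob[of x 1] by simp

lemma chi_sum: "chi n (\<Sum>j\<in>J. f j :: 'a) = (\<Prod>j\<in>J. chi n (f j))"
  by (induction J rule: infinite_finite_induct) (simp_all add: chi_add)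

lemma chi_cases: "chi n (x :: 'a) = 1 \<or> chi n x = -1"
  by (simp add: chi_def)

section \<open>Character sums over subgroups and their annihilators\<close>

text \<open>If \<open>chi n (t * x) = -1\<close> for some \<open>t\<close> in \<open>S\<close>,
  translating the summation variable by \<open>t\<close> negates the sum.\<close>

lemma sum_chi_subgroup:
  assumes "add_closed S"
  shows "(\<Sum>s\<in>S. chi n (s * x :: 'a)) = (if \<forall>s\<in>S. chi n (s * x) = 1 then card S else 0)"
proof (cases "\<forall>s\<in>S. chi n (s * x) = 1")
  case False
  then obtain t where t: "t \<in> S" "chi n (t * x) = -1" using chi_cases by blast
  have "(\<Sum>s\<in>S. chi n (s * x)) = (\<Sum>s\<in>S. chi n ((t + s) * x))"
    by (rule sum.reindex_bij_witness[of _ "\<lambda>s. t + s" "\<lambda>s. t + s"])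
      (use assms t in \<open>auto simp: add_closed_def add_self simp flip: add.assoc\<close>)
  also have "\<dots> = - (\<Sum>s\<in>S. chi n (s * x))"
    by (simp add: distrib_right chi_add t sum_negf)
  finally show ?thesis using False by (simp only: if_False)
qed simp

lemma sum_chi: "(\<Sum>s\<in>UNIV. chi n (s * x :: 'a)) = (if x = 0 then 2 ^ n else 0)"
proof -
  have "(\<forall>s. chi n (s * x) = 1) \<longleftrightarrow> x = 0"
  proof
    assume all: "\<forall>s. chi n (s * x) = 1"
    show "x = 0"
    proof (rule ccontr)
      assume "x \<noteq> 0"
      obtain z :: 'a where "trace2 n z \<noteq> 0" using trace2_surj by blast
      then show False using all[rule_format, of "z / x"] \<open>x \<noteq> 0\<close> by (simp add: chi_def)
    qed
  qed simp
  moreover have "add_closed (UNIV :: 'a set)" by (simp add: add_closed_def)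
  ultimately show ?thesis by (simp add: sum_chi_subgroup card)
qed

text \<open>Evaluate the double sum of \<open>chi n (s * a)\<close> over \<open>s\<close> in
  \<open>S\<close> and all \<open>a\<close> in both orders.\<close>

lemma card_perp:
  assumes S: "add_closed S" and A: "A = {a :: 'a. \<forall>s\<in>S. chi n (a * s) = 1}"
  shows "card A * card S = 2 ^ n"
proof -
  have "(\<Sum>a\<in>UNIV. \<Sum>s\<in>S. chi n (s * a)) = real (card A * card S)"
    by (simp only: sum_chi_subgroup[OF S]) (simp add: A sum.If_cases mult.commute if_distrib[of real] cong: if_cong)
  moreover have "(\<Sum>a\<in>UNIV. \<Sum>s\<in>S. chi n (s * a)) = (\<Sum>s\<in>S. \<Sum>a\<in>UNIV. chi n (a * s))"
    by (subst sum.swap) (simp add: mult.commute)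
  moreover have "\<dots> = 2 ^ n"
    using S by (simp add: sum_chi add_closed_def)
  ultimately have "real (card A * card S) = real (2 ^ n)" by simp
  then show ?thesis by (simp only: of_nat_eq_iff)
qed

lemma add_closed_perp: "add_closed {a :: 'a. \<forall>s\<in>S. chi n (a * s) = 1}"
  by (simp add: add_closed_def distrib_right chi_add)

text \<open>One inclusion is immediate, and by \<open>card_perp\<close> both sets have
  \<open>2^n / card A\<close> elements.\<close>

lemma perp_perp:
  assumes S: "add_closed S" and A: "A = {a :: 'a. \<forall>s\<in>S. chi n (a * s) = 1}"
  shows "{x. \<forall>a\<in>A. chi n (x * a) = 1} = S"
proof -
  let ?B = "{x. \<forall>a\<in>A. chi n (x * a) = 1}"
  have "add_closed A" using add_closed_perp A by simp
  then have "card ?B * card A = 2 ^ n" by (rule card_perp) simp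
  moreover have "card S * card A = 2 ^ n"
    using card_perp[OF S A] by (simp only: mult.commute)
  ultimately have "card S * card A = card ?B * card A" "card A \<noteq> 0"
    by (simp, intro notI, simp)
  then have "card S = card ?B" by (simp only: mult_cancel2) blast
  moreover have "S \<subseteq> ?B" using A by (auto simp: mult.commute)
  ultimately show ?thesis using card_subset_eq[of ?B S] by simp
qed

text \<open>Writes the indicator function of \<open>S\<close> as a character sum, so that points
  with coordinates in \<open>S\<close> can be counted.\<close>

lemma sum_chi_perp:
  assumes S: "add_closed S" and A: "A = {a :: 'a. \<forall>s\<in>S. chi n (a * s) = 1}"
  shows "(\<Sum>a\<in>A. chi n (a * x)) = (if x \<in> S then card A else 0)"
proof -
  have "add_closed A" using add_closed_perp A by simp
  moreover have "x \<in> S \<longleftrightarrow> (\<forall>a\<in>A. chi n (x * a) = 1)"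
    using perp_perp[OF S A] by blast
  then have "x \<in> S \<longleftrightarrow> (\<forall>a\<in>A. chi n (a * x) = 1)"
    by (simp add: mult.commute)
  ultimately show ?thesis by (simp add: sum_chi_subgroup)
qed

section \<open>Kloosterman sums and their fourth moment\<close>

text \<open>After the square is expanded, orthogonality in \<open>a\<close> and \<open>b\<close>
  keeps only the pairs on which both \<open>f\<close> and \<open>g\<close> agree.\<close>

lemma second_moment:
  fixes f g :: "'b \<Rightarrow> 'a"
  assumes P: "finite P"
  shows "(\<Sum>a\<in>UNIV. \<Sum>b\<in>UNIV. (\<Sum>p\<in>P. chi n (a * f p + b * g p))\<^sup>2) =
    (2 ^ n)\<^sup>2 * card {w \<in> P \<times> P. f (fst w) = f (snd w) \<and> g (fst w) = g (snd w)}"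
proof -
  have sq: "(\<Sum>p\<in>P. chi n (a * f p + b * g p))\<^sup>2 =
    (\<Sum>w\<in>P \<times> P. chi n (a * (f (fst w) + f (snd w))) * chi n (b * (g (fst w) + g (snd w))))" for a b
    by (simp add: power2_eq_square sum_product sum.cartesian_product case_prod_unfold
        chi_add distrib_left mult_ac)
  have "(\<Sum>a\<in>UNIV. \<Sum>b\<in>UNIV. (\<Sum>p\<in>P. chi n (a * f p + b * g p))\<^sup>2) =
    (\<Sum>w\<in>P \<times> P. \<Sum>a\<in>UNIV. \<Sum>b\<in>UNIV.
      chi n (a * (f (fst w) + f (snd w))) * chi n (b * (g (fst w) + g (snd w))))"
    unfolding sq by (simp only: sum.swap[of _ UNIV "P \<times> P"])
  also have "\<dots> = (\<Sum>w\<in>P \<times> P.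
      (\<Sum>a\<in>UNIV. chi n (a * (f (fst w) + f (snd w)))) *
      (\<Sum>b\<in>UNIV. chi n (b * (g (fst w) + g (snd w)))))"
    by (simp add: sum_product)
  also have "\<dots> = (\<Sum>w\<in>P \<times> P. if f (fst w) = f (snd w) \<and> g (fst w) = g (snd w) then (2 ^ n)\<^sup>2 else 0)"
    by (intro sum.cong) (auto simp: sum_chi add_eq_0 power2_eq_square)
  also have "\<dots> = (2 ^ n)\<^sup>2 * card {w \<in> P \<times> P. f (fst w) = f (snd w) \<and> g (fst w) = g (snd w)}"
    using P by (simp add: sum.If_cases Int_def)
  finally show ?thesis .
qed

lemma kloosterman_scale:
  assumes "t \<noteq> 0"
  shows "kloosterman n (a * t) (b / t :: 'a) = kloosterman n a b"
  unfolding kloosterman_def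
  by (rule sum.reindex_bij_witness[of _ "\<lambda>x. x / t" "\<lambda>x. x * t"]) (use assms in \<open>auto simp: mult_ac\<close>)

text \<open>If \<open>x + y\<close> is nonzero, both pairs have the same product as well, so
  \<open>z\<close> is a root of the quadratic with roots \<open>x\<close> and \<open>y\<close>.
  Otherwise \<open>x = y\<close> and \<open>z = w\<close>.\<close>

lemma pair_sums_determine_pair:
  fixes x y z w :: 'a
  assumes nz: "x \<noteq> 0" "y \<noteq> 0" "z \<noteq> 0" "w \<noteq> 0"
    and sums: "x + y = z + w" "1 / x + 1 / y = 1 / z + 1 / w"
  shows "x = y \<and> z = w \<or> z = x \<and> w = y \<or> z = y \<and> w = x"
proof (cases "x + y = 0")
  case True
  then show ?thesis using sums add_eq_0 by metis
next
  case False
  have "(x + y) * (z * w) = (z + w) * (x * y)"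
    using sums(2) nz by (simp add: field_simps)
  then have "z * w = x * y" using False sums(1) by simp
  moreover have w: "w = x + y + z"
    using sums(1) add_self[of z] by (simp add: algebra_simps)
  ultimately have "(z + x) * (z + y) = 0"
    using add_self[of "x * y"] by (simp add: algebra_simps)
  then have "z = x \<or> z = y" by (simp add: add_eq_0)
  then show ?thesis using w add_self by (metis add.commute add.left_commute add_0_right)
qed

text \<open>The square of a Kloosterman sum is a character sum over pairs, so
  \<open>second_moment\<close> turns the fourth moment into a count of pairs of pairs.\<close>

lemma kloosterman_fourth_moment:
  "(\<Sum>a\<in>UNIV. \<Sum>b\<in>UNIV. kloosterman n a (b :: 'a) ^ 4) \<le> (2 ^ n)\<^sup>2 * (3 * (2 ^ n - 1)\<^sup>2)"
proof -
  let ?N = "UNIV - {0 :: 'a}" and ?f = "\<lambda>p :: 'a \<times> 'a. fst p + snd p"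
    and ?g = "\<lambda>p :: 'a \<times> 'a. 1 / fst p + 1 / snd p"
  let ?E = "{w \<in> (?N \<times> ?N) \<times> (?N \<times> ?N). ?f (fst w) = ?f (snd w) \<and> ?g (fst w) = ?g (snd w)}"
  have sq: "(kloosterman n a b)\<^sup>2 = (\<Sum>p\<in>?N \<times> ?N. chi n (a * ?f p + b * ?g p))" for a b
    unfolding kloosterman_def power2_eq_square sum_product sum.cartesian_product
    by (intro sum.cong) (auto simp: chi_add distrib_left mult_ac)
  \<comment> \<open>One family for each alternative of
    \<open>pair_sums_determine_pair\<close>.\<close>
  have "?E \<subseteq> (\<lambda>(x, y). ((x, x), (y, y))) ` (?N \<times> ?N) \<union> (\<lambda>p. (p, p)) ` (?N \<times> ?N) \<union>
      (\<lambda>p. (p, prod.swap p)) ` (?N \<times> ?N)" (is "_ \<subseteq> ?E1 \<union> ?E2 \<union> ?E3")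
  proof
    fix u assume "u \<in> ?E"
    moreover obtain x y z w where u: "u = ((x, y), (z, w))" by (metis surj_pair)
    ultimately have nz: "x \<noteq> 0" "y \<noteq> 0" "z \<noteq> 0" "w \<noteq> 0"
      and "x + y = z + w" "1 / x + 1 / y = 1 / z + 1 / w" by auto
    then have "x = y \<and> z = w \<or> z = x \<and> w = y \<or> z = y \<and> w = x"
      by (rule pair_sums_determine_pair)
    then show "u \<in> ?E1 \<union> ?E2 \<union> ?E3"
      using nz unfolding u by (auto simp: image_iff)
  qed
  then have "card ?E \<le> card (?E1 \<union> ?E2 \<union> ?E3)" by (intro card_mono) auto
  also have "\<dots> \<le> card ?E1 + card ?E2 + card ?E3"
    by (meson card_Un_le add_mono order.refl order.trans)
  also have "\<dots> \<le> card (?N \<times> ?N) + card (?N \<times> ?N) + card (?N \<times> ?N)"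
    by (intro add_mono card_image_le) auto
  also have "\<dots> = 3 * (2 ^ n - 1)\<^sup>2"
    by (simp add: card_cartesian_product card_Diff_subset card power2_eq_square)
  finally have "real (card ?E) \<le> real (3 * (2 ^ n - 1)\<^sup>2)" by (rule of_nat_mono)
  then have E: "real (card ?E) \<le> 3 * (2 ^ n - 1)\<^sup>2" by (simp add: of_nat_diff)
  have "(\<Sum>a\<in>UNIV. \<Sum>b\<in>UNIV. kloosterman n a (b :: 'a) ^ 4) =
      (\<Sum>a\<in>UNIV. \<Sum>b\<in>UNIV. (\<Sum>p\<in>?N \<times> ?N. chi n (a * ?f p + b * ?g p))\<^sup>2)"
    by (simp flip: sq)
  also have "\<dots> = (2 ^ n)\<^sup>2 * real (card ?E)"
    using second_moment[of "?N \<times> ?N" ?f ?g] by simp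
  also have "\<dots> \<le> (2 ^ n)\<^sup>2 * (3 * (2 ^ n - 1)\<^sup>2)"
    by (intro mult_left_mono E) simp
  finally show ?thesis .
qed

text \<open>
  By \<open>kloosterman_scale\<close>, each sum occurs \<open>2^n - 1\<close> times in the fourth moment.
\<close>

lemma kloosterman_bound:
  assumes "a \<noteq> 0"
  shows "kloosterman n a (w :: 'a) ^ 4 \<le> 3 * (2 ^ n) ^ 3"
proof -
  let ?N = "UNIV - {0 :: 'a}" and ?q = "2 ^ n :: real"
  have q: "?q - 1 > 0" using n_pos by simp
  have "(?q - 1) * kloosterman n a w ^ 4 = (\<Sum>t\<in>?N. kloosterman n (a * t) (w / t) ^ 4)"
    by (simp add: kloosterman_scale card_Diff_subset card of_nat_diff)
  also have "\<dots> = (\<Sum>c\<in>(\<lambda>t. (a * t, w / t)) ` ?N. kloosterman n (fst c) (snd c) ^ 4)"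
    using assms by (subst sum.reindex) (auto simp: inj_on_def)
  also have "\<dots> \<le> (\<Sum>c\<in>UNIV \<times> UNIV. kloosterman n (fst c) (snd c :: 'a) ^ 4)"
    by (intro sum_mono2) auto
  also have "\<dots> = (\<Sum>a\<in>UNIV. \<Sum>b\<in>UNIV. kloosterman n a (b :: 'a) ^ 4)"
    by (simp add: sum.cartesian_product case_prod_unfold)
  also have "\<dots> \<le> ?q\<^sup>2 * (3 * (?q - 1)\<^sup>2)" by (rule kloosterman_fourth_moment)
  also have "\<dots> = (?q - 1) * (3 * ?q\<^sup>2 * (?q - 1))" by (simp add: power2_eq_square algebra_simps)
  finally have "kloosterman n a w ^ 4 \<le> 3 * ?q\<^sup>2 * (?q - 1)" using q by simp
  also have "\<dots> \<le> 3 * ?q\<^sup>2 * ?q" by (intro mult_left_mono) auto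
  finally show ?thesis by (simp add: power2_eq_square power3_eq_cube mult_ac)
qed

section \<open>Points of the conic with coordinates in a subgroup\<close>

text \<open>
  After detecting the conic with a character sum over \<open>\<mu>\<^sup>2\<close>, the phase is linear in \<open>Y\<close>
  because the trace is invariant under squaring.
\<close>

lemma conic_sum:
  fixes d u v r :: 'a
  assumes r: "r\<^sup>2 = u * v"
  shows "(\<Sum>p | (fst p)\<^sup>2 + fst p * snd p + (snd p)\<^sup>2 = d\<^sup>2. chi n (u * fst p + v * snd p)) =
    (if u = 0 \<and> v = 0 then 2 ^ n else 0) + chi n (1 :: 'a) * kloosterman n d (u + v + r)"
    (is "sum ?c {p. ?Q p = _} = _")
proof -
  let ?q = "2 ^ n :: real"
  define G where "G \<mu> = (\<Sum>X\<in>UNIV. \<Sum>Y\<in>UNIV. chi n (\<mu>\<^sup>2 * (X\<^sup>2 + X * Y + Y\<^sup>2 + d\<^sup>2)) * chi n (u * X + v * Y))" for \<mu>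
  have split: "chi n (\<mu>\<^sup>2 * (X\<^sup>2 + X * Y + Y\<^sup>2 + d\<^sup>2)) * chi n (u * X + v * Y) =
    chi n (\<mu> * X + \<mu> * d + u * X) * chi n (Y * (\<mu>\<^sup>2 * X + \<mu> + v))" for \<mu> X Y
  proof -
    have "\<mu>\<^sup>2 * (X\<^sup>2 + X * Y + Y\<^sup>2 + d\<^sup>2) = (\<mu> * X)\<^sup>2 + \<mu>\<^sup>2 * X * Y + (\<mu> * Y)\<^sup>2 + (\<mu> * d)\<^sup>2"
      by (simp add: power2_eq_square algebra_simps)
    then have "chi n (\<mu>\<^sup>2 * (X\<^sup>2 + X * Y + Y\<^sup>2 + d\<^sup>2)) =
        chi n (\<mu> * X) * chi n (\<mu>\<^sup>2 * X * Y) * chi n (\<mu> * Y) * chi n (\<mu> * d)"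
      by (simp only: chi_add chi_square)
    then show ?thesis
      by (simp add: chi_add distrib_left mult_ac)
  qed
  \<comment> \<open>The sum over \<open>Y\<close> vanishes unless the coefficient of
    \<open>Y\<close> is zero.\<close>
  have G: "G \<mu> = ?q * (\<Sum>X | \<mu>\<^sup>2 * X + \<mu> + v = 0. chi n (\<mu> * X + \<mu> * d + u * X))" for \<mu>
    unfolding G_def split sum_distrib_left[symmetric] sum_chi
    by (simp add: if_distrib sum.If_cases sum_distrib_left mult.commute cong: if_cong)
  have G0: "G 0 = ?q * (if u = 0 \<and> v = 0 then ?q else 0)"
    using sum_chi[of u] by (simp add: G mult.commute card chi_0)
  have G1: "G \<mu> = ?q * (chi n (1 :: 'a) * chi n (d * \<mu> + (u + v + r) / \<mu>))" if "\<mu> \<noteq> 0" for \<mu>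
  proof -
    have "\<mu>\<^sup>2 * X + \<mu> + v = 0 \<longleftrightarrow> X = (\<mu> + v) / \<mu>\<^sup>2" for X
      using that add_eq_0[of "\<mu>\<^sup>2 * X" "\<mu> + v"] by (auto simp: field_simps)
    then have "{X. \<mu>\<^sup>2 * X + \<mu> + v = 0} = {(\<mu> + v) / \<mu>\<^sup>2}" by auto
    then have "G \<mu> = ?q * chi n (\<mu> * ((\<mu> + v) / \<mu>\<^sup>2) + \<mu> * d + u * ((\<mu> + v) / \<mu>\<^sup>2))"
      by (simp add: G)
    \<comment> \<open>The term \<open>u * v / \<mu>^2\<close> is the square of
      \<open>r / \<mu>\<close>, which \<open>chi\<close> replaces by \<open>r / \<mu>\<close>. What
      remains is a Kloosterman phase, up to the constant 1.\<close>
    also have "\<mu> * ((\<mu> + v) / \<mu>\<^sup>2) + \<mu> * d + u * ((\<mu> + v) / \<mu>\<^sup>2) =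
        1 + (d * \<mu> + (u + v) / \<mu>) + (r / \<mu>)\<^sup>2"
      using that r by (simp add: field_simps power2_eq_square)
    finally show ?thesis
      by (simp add: chi_add chi_square add_divide_distrib)
  qed
  have "?q * sum ?c {p. ?Q p = d\<^sup>2} =
      (\<Sum>p\<in>UNIV. (\<Sum>l\<in>UNIV. chi n (l * (?Q p + d\<^sup>2))) * ?c p)"
    by (simp add: sum_chi add_eq_0 if_distrib[of "\<lambda>x. x * _"] sum.If_cases
        sum_distrib_left cong: if_cong)
  also have "\<dots> = (\<Sum>l\<in>UNIV. \<Sum>p\<in>UNIV. chi n (l * (?Q p + d\<^sup>2)) * ?c p)"
    by (subst sum.swap) (simp add: sum_distrib_right)
  also have "\<dots> = (\<Sum>\<mu>\<in>UNIV. \<Sum>p\<in>UNIV. chi n (\<mu>\<^sup>2 * (?Q p + d\<^sup>2)) * ?c p)"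
    using sum.reindex_bij_betw[OF bij_square,
        of "\<lambda>l. \<Sum>p\<in>UNIV. chi n (l * (?Q p + d\<^sup>2)) * ?c p"] by simp
  also have "\<dots> = (\<Sum>\<mu>\<in>UNIV. G \<mu>)"
    by (simp add: G_def sum.cartesian_product case_prod_unfold flip: UNIV_Times_UNIV)
  also have "\<dots> = G 0 + (\<Sum>\<mu>\<in>UNIV - {0}. G \<mu>)"
    by (simp add: sum.remove)
  also have "(\<Sum>\<mu>\<in>UNIV - {0}. G \<mu>) = ?q * (chi n (1 :: 'a) * kloosterman n d (u + v + r))"
    by (simp add: G1 kloosterman_def sum_distrib_left)
  finally have "?q * sum ?c {p. ?Q p = d\<^sup>2} =
      ?q * ((if u = 0 \<and> v = 0 then ?q else 0) + chi n (1 :: 'a) * kloosterman n d (u + v + r))"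
    by (simp add: G0 distrib_left)
  then show ?thesis by simp
qed

text \<open>Membership in \<open>S\<close> is detected by characters from its annihilator
  \<open>A\<close>, of size \<open>2^m\<close>. The pair \<open>(0, 0)\<close> gives the main term
  \<open>2^n\<close>, and each of the \<open>4^m\<close> pairs an error of at most \<open>B\<close>.
  The bound 3 is the number of degenerate points to be avoided later.\<close>

lemma conic_points_subgroup:
  fixes d :: 'a
  assumes S: "add_closed S" and cS: "card S * 2 ^ m = 2 ^ n"
    and nm: "8 * m + 12 \<le> n" and d: "d \<noteq> 0"
  shows "card {p \<in> S \<times> S. (fst p)\<^sup>2 + fst p * snd p + (snd p)\<^sup>2 = d\<^sup>2} > 3"
proof -
  let ?q = "2 ^ n :: real" and ?C = "{p. (fst p)\<^sup>2 + fst p * snd p + (snd p)\<^sup>2 = d\<^sup>2}"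
  define A where "A = {a. \<forall>s\<in>S. chi n (a * s) = 1}"
  \<comment> \<open>Chosen so that all \<open>4^m\<close> errors together amount to half of the main
    term.\<close>
  define B where "B = ?q / (2 * 4 ^ m)"
  have "card A * card S = 2 ^ m * card S"
    using card_perp[OF S A_def] cS by (simp add: mult.commute)
  moreover have "card S \<noteq> 0" using cS by (intro notI) simp
  ultimately have cA: "card A = 2 ^ m" by (simp only: mult_cancel2) blast
  have "0 \<in> A" by (simp add: A_def chi_0)
  have K: "\<bar>kloosterman n d w\<bar> \<le> B" for w
  proof (rule power_le_imp_le_base)
    \<comment> \<open>The exponent is that of \<open>256 * (2 * 4^m)^4\<close>; hence
      \<open>B^4\<close> is at least \<open>256 * ?q^3\<close>, above the Kloosterman bound
      \<open>3 * ?q^3\<close>.\<close>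
    have "(2 :: real) ^ (8 * m + 12) \<le> ?q" by (intro power_increasing nm) simp
    then have "?q ^ 3 * 2 ^ (8 * m + 12) \<le> ?q ^ 3 * ?q" by (intro mult_left_mono) auto
    then have "?q ^ 3 * 2 ^ (8 * m + 12) \<le> ?q ^ 4" by (simp flip: power_Suc2)
    moreover have "(2 :: real) ^ (8 * m + 12) = 256 * (2 * 4 ^ m) ^ 4"
    proof -
      have "(2 :: real) ^ (8 * m) = (4 ^ m) ^ 4"
        using power_mult[of "2 :: real" 2 "m * 4"] by (simp add: power_mult mult.commute)
      then show ?thesis by (simp add: power_add power_mult_distrib)
    qed
    ultimately have "256 * ?q ^ 3 \<le> B ^ 4"
      by (simp only: B_def power_divide) (simp add: pos_le_divide_eq mult_ac)
    moreover have "kloosterman n d w ^ 4 \<le> 3 * ?q ^ 3" by (rule kloosterman_bound[OF d])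
    moreover have "3 * ?q ^ 3 \<le> 256 * ?q ^ 3" by (intro mult_right_mono) auto
    ultimately have "kloosterman n d w ^ 4 \<le> B ^ 4" by linarith
    then show "\<bar>kloosterman n d w\<bar> ^ Suc 3 \<le> B ^ Suc 3" by simp
  qed (simp add: B_def)
  have lower: "(\<Sum>p\<in>?C. chi n (u * fst p + v * snd p)) \<ge> (if u = 0 \<and> v = 0 then ?q else 0) - B" for u v
  proof -
    obtain r where "r\<^sup>2 = u * v" using bij_square by (metis bij_def surjD)
    moreover have "chi n (1 :: 'a) * kloosterman n d (u + v + r) \<ge> - B"
      using K[of "u + v + r"] by (auto simp: chi_def)
    ultimately show ?thesis by (simp add: conic_sum)
  qed
  have "?q - 4 ^ m * B = (\<Sum>u\<in>A. \<Sum>v\<in>A. (if u = 0 \<and> v = 0 then ?q else 0) - B)"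
  proof -
    have "(\<Sum>v\<in>A. if u = 0 \<and> v = 0 then ?q else 0) = (if u = 0 then ?q else 0)" for u :: 'a
      using \<open>0 \<in> A\<close> by (cases "u = 0") simp_all
    then have "(\<Sum>u\<in>A. \<Sum>v\<in>A. (if u = 0 \<and> v = 0 then ?q else 0) - B) = ?q - 2 ^ m * (2 ^ m * B)"
      using \<open>0 \<in> A\<close> by (simp only: sum_subtractf) (simp add: cA)
    moreover have "(4 :: real) ^ m = 2 ^ m * 2 ^ m" by (simp flip: power_mult_distrib)
    ultimately show ?thesis by simp
  qed
  also have "\<dots> \<le> (\<Sum>u\<in>A. \<Sum>v\<in>A. \<Sum>p\<in>?C. chi n (u * fst p + v * snd p))"
    by (intro sum_mono lower)
  also have "\<dots> = (\<Sum>p\<in>?C. \<Sum>u\<in>A. \<Sum>v\<in>A. chi n (u * fst p) * chi n (v * snd p))"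
    by (simp only: chi_add sum.swap[of _ A ?C])
  also have "\<dots> = (\<Sum>p\<in>?C. (\<Sum>u\<in>A. chi n (u * fst p)) * (\<Sum>v\<in>A. chi n (v * snd p)))"
    by (simp add: sum_product)
  also have "\<dots> = (\<Sum>p\<in>?C. if p \<in> S \<times> S then 4 ^ m else 0)"
    by (intro sum.cong)
      (auto simp: sum_chi_perp[OF S A_def] cA mem_Times_iff simp flip: power_mult_distrib)
  also have "\<dots> = 4 ^ m * real (card {p \<in> S \<times> S. p \<in> ?C})"
    by (simp add: sum.If_cases Int_def conj_commute)
  finally have "?q - 4 ^ m * B \<le> 4 ^ m * real (card {p \<in> S \<times> S. p \<in> ?C})" .
  moreover have "4 ^ m * B = ?q / 2" by (simp add: B_def)
  moreover have "?q \<ge> 4 ^ m * 8"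
  proof -
    have "(2 :: real) ^ (2 * m + 3) \<le> ?q" using nm by (intro power_increasing) auto
    then show ?thesis by (simp add: power_add power_mult)
  qed
  ultimately have "4 ^ m * 4 \<le> 4 ^ m * real (card {p \<in> S \<times> S. p \<in> ?C})" by linarith
  then have "4 \<le> real (card {p \<in> S \<times> S. p \<in> ?C})" by (subst (asm) mult_le_cancel_left_pos) simp_all
  then show ?thesis by simp
qed

section \<open>Linearized polynomials and enlarging their kernels\<close>

lemma lin_poly_add: "lin_poly b m (x + y :: 'a) = lin_poly b m x + lin_poly b m y"
  by (simp add: lin_poly_def frob_add distrib_left sum.distrib)

lemma lin_poly_0: "lin_poly b m (0 :: 'a) = 0"
  by (simp add: lin_poly_def power_0_left)

lemma lin_poly_extend_coeffs:
  assumes "\<And>i. i > m \<Longrightarrow> b i = 0"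
  shows "lin_poly (extend_coeffs X b) (Suc m) x = (lin_poly b m x)\<^sup>2 + X * lin_poly b m (x :: 'a)"
proof -
  have "(lin_poly b m x)\<^sup>2 = (\<Sum>i\<le>m. (b i)\<^sup>2 * x ^ (2 ^ Suc i))"
    using frob_sum[of "\<lambda>i. b i * x ^ (2 ^ i)" "{..m}" 1]
    by (simp add: lin_poly_def power_mult_distrib mult.commute[of 2] power_mult)
  also have "\<dots> = (\<Sum>i\<le>Suc m. (case i of 0 \<Rightarrow> 0 | Suc j \<Rightarrow> (b j)\<^sup>2) * x ^ (2 ^ i))"
    unfolding sum.atMost_Suc_shift by simp
  finally show ?thesis
    using assms by (simp add: lin_poly_def extend_coeffs_def distrib_right sum.distrib
        sum_distrib_left mult.assoc)
qed

text \<open>Translation by \<open>z\<close> exchanges the fiber and the kernel.\<close>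

lemma card_fiber_lin_poly:
  "card {x. lin_poly b m x = lin_poly b m z} = card {x :: 'a. lin_poly b m x = 0}"
  by (rule bij_betw_same_card[of "\<lambda>x. x + z"], rule bij_betw_byWitness[of _ "\<lambda>x. x + z"])
    (auto simp: lin_poly_add add_self add_eq_0 add.assoc)

text \<open>As \<open>L^2 + X * L = L * (L + X)\<close>, the new kernel is the disjoint union of two
  fibers of \<open>L\<close>, both nonempty because \<open>X\<close> is a value of
  \<open>L\<close>.\<close>

lemma splits_with_degree_extend:
  assumes b: "splits_with_degree b m" and X: "lin_poly b m g = X" "X \<noteq> (0 :: 'a)"
  shows "splits_with_degree (extend_coeffs X b) (Suc m)"
proof -
  have "lin_poly (extend_coeffs X b) (Suc m) x = 0 \<longleftrightarrow> lin_poly b m x = 0 \<or> lin_poly b m x = X" for x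
  proof -
    have "lin_poly (extend_coeffs X b) (Suc m) x = lin_poly b m x * (lin_poly b m x + X)"
      using b by (subst lin_poly_extend_coeffs)
        (auto simp: splits_with_degree_def power2_eq_square algebra_simps)
    then show ?thesis by (simp add: add_eq_0)
  qed
  then have "{x. lin_poly (extend_coeffs X b) (Suc m) x = 0} =
      {x. lin_poly b m x = 0} \<union> {x. lin_poly b m x = lin_poly b m g}"
    using X by auto
  moreover have "card \<dots> = card {x. lin_poly b m x = 0} + card {x. lin_poly b m x = lin_poly b m g}"
    using X by (intro card_Un_disjoint) auto
  ultimately show ?thesis
    using b by (simp add: splits_with_degree_def extend_coeffs_def card_fiber_lin_poly
        split: nat.split)
qed

lemma card_range_lin_poly:
  assumes b: "splits_with_degree b m"
  shows "card (range (lin_poly b m :: 'a \<Rightarrow> 'a)) * 2 ^ m = 2 ^ n"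
proof -
  have "CARD('a) = (\<Sum>y\<in>range (lin_poly b m). card {x. lin_poly b m x = y})"
    using sum.image_gen[of "UNIV :: 'a set" "\<lambda>_. 1 :: nat" "lin_poly b m"] by simp
  also have "\<dots> = (\<Sum>y\<in>range (lin_poly b m). 2 ^ m)"
    using b by (intro sum.cong) (auto simp: card_fiber_lin_poly splits_with_degree_def)
  finally show ?thesis by (simp add: card)
qed

lemma add_closed_range_lin_poly: "add_closed (range (lin_poly b m :: 'a \<Rightarrow> 'a))"
  unfolding add_closed_def
  by (auto simp flip: lin_poly_add) (metis lin_poly_0 rangeI)

text \<open>By induction: extending by \<open>X\<close> changes the second coefficient to
  \<open>(b m)^2 + X\<close>, and the image is large enough to contain an \<open>X\<close> other
  than \<open>0\<close> and \<open>(b m)^2\<close>.\<close>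

lemma exists_splits_with_degree:
  "m + 3 \<le> n \<Longrightarrow> \<exists>b :: nat \<Rightarrow> 'a. splits_with_degree b (Suc m) \<and> b m \<noteq> 0"
proof (induction m)
  case 0
  \<comment> \<open>The polynomial \<open>x\<close>, extended by its value 1 to
    \<open>x^2 + x\<close>.\<close>
  define b where "b = (\<lambda>i :: nat. if i = 0 then 1 else 0 :: 'a)"
  have "splits_with_degree b 0"
    by (simp add: splits_with_degree_def b_def lin_poly_def)
  then have "splits_with_degree (extend_coeffs 1 b) (Suc 0)"
    by (rule splits_with_degree_extend[of _ _ 1]) (simp_all add: lin_poly_def b_def)
  moreover have "extend_coeffs 1 b 0 \<noteq> 0" by (simp add: extend_coeffs_def b_def)
  ultimately show ?case by blast
next
  case (Suc m)
  then obtain b :: "nat \<Rightarrow> 'a" where b: "splits_with_degree b (Suc m)" by auto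
  let ?R = "range (lin_poly b (Suc m))"
  have "card ?R * 2 ^ Suc m = 2 ^ n" by (rule card_range_lin_poly) fact
  moreover have "(2 :: nat) ^ (2 + Suc m) \<le> 2 ^ n" using Suc.prems by (intro power_increasing) auto
  ultimately have "4 * 2 ^ Suc m \<le> card ?R * 2 ^ Suc m" by simp
  then have "4 \<le> card ?R" by (simp only: mult_le_cancel2) simp
  moreover have "card {0, (b m)\<^sup>2} \<le> 2" by (simp add: card_insert_if)
  ultimately have "\<not> ?R \<subseteq> {0, (b m)\<^sup>2}" using card_mono[of "{0, (b m)\<^sup>2}" ?R] by auto
  then obtain g where g: "lin_poly b (Suc m) g \<noteq> 0" "lin_poly b (Suc m) g \<noteq> (b m)\<^sup>2" by auto
  let ?b = "extend_coeffs (lin_poly b (Suc m) g) b"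
  have "splits_with_degree ?b (Suc (Suc m))"
    using b g by (intro splits_with_degree_extend) auto
  moreover have "?b (Suc m) \<noteq> 0"
    using b g add_eq_0[of "(b m)\<^sup>2" "lin_poly b (Suc m) g"]
    by (simp add: extend_coeffs_def splits_with_degree_def)
  ultimately show ?case by blast
qed

text \<open>Two extensions, by \<open>X\<close> and then by \<open>Y * (Y + X)\<close>, adjoin
  preimages of \<open>X\<close> and \<open>Y\<close> to the kernel; the second coefficient vanishes
  exactly when \<open>(X, Y)\<close> lies on the conic.\<close>

lemma exists_splits_with_degree_gap:
  assumes "8 * m + 20 \<le> n"
  shows "\<exists>b :: nat \<Rightarrow> 'a. splits_with_degree b (m + 3) \<and> b (m + 2) = 0"
proof -
  obtain b :: "nat \<Rightarrow> 'a" where b: "splits_with_degree b (Suc m)" and nz: "b m \<noteq> 0"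
    using exists_splits_with_degree[of m] assms by auto
  define S where "S = range (lin_poly b (Suc m))"
  define d where "d = (b m)\<^sup>2"
  let ?P = "{p \<in> S \<times> S. (fst p)\<^sup>2 + fst p * snd p + (snd p)\<^sup>2 = d\<^sup>2}"
  \<comment> \<open>The conic points with \<open>X = 0\<close>, \<open>Y = 0\<close> or
    \<open>X = Y\<close>, for which the kernel would not grow twice.\<close>
  let ?T = "{(0, d), (d, 0), (d, d)}"
  have "card ?P > 3"
    \<comment> \<open>The image has index \<open>2^(Suc m)\<close>, and
      \<open>8 * Suc m + 12 = 8 * m + 20\<close>.\<close>
    by (rule conic_points_subgroup[of _ "Suc m"])
      (use assms nz card_range_lin_poly[OF b] in \<open>simp_all add: S_def d_def add_closed_range_lin_poly\<close>)
  moreover have "card ?T \<le> 3" by (simp add: card_insert_if)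
  ultimately have "\<not> ?P \<subseteq> ?T" using card_mono[of ?T ?P] by auto
  then obtain p where "p \<in> ?P" "p \<notin> ?T" by blast
  then obtain X Y where XY: "X \<in> S" "Y \<in> S" "X\<^sup>2 + X * Y + Y\<^sup>2 = d\<^sup>2" "(X, Y) \<notin> ?T"
    by (cases p) auto
  have sq: "x = y" if "x\<^sup>2 = y\<^sup>2" for x y :: 'a
    using bij_square that by (auto simp: bij_def dest: injD)
  have X0: "X \<noteq> 0" using XY(3,4) sq[of Y d] by auto
  have "Y \<noteq> 0" using XY(3,4) sq[of X d] by auto
  moreover have "X \<noteq> Y"
  proof
    assume "X = Y"
    then have "X\<^sup>2 = d\<^sup>2"
      using XY(3) by (simp only: power2_eq_square add_self add_0_left)
    then show False using XY(4) sq[of X d] \<open>X = Y\<close> by simp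
  qed
  ultimately have nz2: "Y * (Y + X) \<noteq> 0" by (auto simp: add_eq_0)
  obtain x y where x: "lin_poly b (Suc m) x = X" and y: "lin_poly b (Suc m) y = Y"
    using XY(1,2) by (auto simp: S_def)
  define c where "c = extend_coeffs X b"
  have c: "splits_with_degree c (Suc (Suc m))"
    unfolding c_def by (rule splits_with_degree_extend[OF b x X0])
  have cy: "lin_poly c (Suc (Suc m)) y = Y * (Y + X)"
    unfolding c_def using b
    by (subst lin_poly_extend_coeffs) (auto simp: splits_with_degree_def y power2_eq_square algebra_simps)
  let ?e = "extend_coeffs (Y * (Y + X)) c"
  have "splits_with_degree ?e (Suc (Suc (Suc m)))"
    by (rule splits_with_degree_extend[OF c cy nz2])
  moreover have "?e (Suc (Suc m)) = (d + X)\<^sup>2 + Y * (Y + X)"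
    using b c by (simp add: extend_coeffs_def splits_with_degree_def d_def c_def)
  moreover have "\<dots> = d\<^sup>2 + d\<^sup>2"
    unfolding square_add using XY(3) by (simp add: power2_eq_square algebra_simps)
  ultimately show ?thesis
    using add_self[of "d\<^sup>2"] by (auto simp: eval_nat_numeral)
qed

section \<open>The adjoint polynomial for the trace form\<close>

text \<open>Raising the \<open>i\<close>-th term to the power \<open>2^(k - i)\<close> does not
  change \<open>chi\<close> and brings every power of \<open>x\<close> to
  \<open>x^(2^k)\<close>.\<close>

lemma chi_adjoint:
  "chi n (y * lin_poly b k x :: 'a) =
    chi n (x ^ (2 ^ k) * lin_poly (\<lambda>j. b (k - j) ^ (2 ^ j)) k y)"
proof -
  have "lin_poly (\<lambda>j. b (k - j) ^ (2 ^ j)) k y = (\<Sum>i\<le>k. (b i * y) ^ (2 ^ (k - i)))"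
    unfolding lin_poly_def
    by (rule sum.reindex_bij_witness[of _ "\<lambda>i. k - i" "\<lambda>i. k - i"])
      (auto simp: power_mult_distrib)
  then have "chi n (x ^ (2 ^ k) * lin_poly (\<lambda>j. b (k - j) ^ (2 ^ j)) k y) =
      (\<Prod>i\<le>k. chi n (x ^ (2 ^ k) * (b i * y) ^ (2 ^ (k - i))))"
    by (simp add: sum_distrib_left chi_sum)
  also have "\<dots> = (\<Prod>i\<le>k. chi n ((y * (b i * x ^ (2 ^ i))) ^ (2 ^ (k - i))))"
  proof (intro prod.cong refl)
    fix i assume "i \<in> {..k}"
    then have "(2 :: nat) ^ i * 2 ^ (k - i) = 2 ^ k" by (simp flip: power_add)
    then have "(x ^ (2 ^ i)) ^ (2 ^ (k - i)) = x ^ (2 ^ k)" by (metis power_mult)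
    then show "chi n (x ^ (2 ^ k) * (b i * y) ^ (2 ^ (k - i))) =
        chi n ((y * (b i * x ^ (2 ^ i))) ^ (2 ^ (k - i)))"
      by (simp add: power_mult_distrib mult_ac)
  qed
  also have "\<dots> = chi n (y * lin_poly b k x)"
    by (simp add: lin_poly_def sum_distrib_left chi_sum chi_frob)
  finally show ?thesis by simp
qed

text \<open>The double sum of \<open>chi n (y * lin_poly b k x)\<close> counts the kernel of
  \<open>L\<close> when \<open>y\<close> is summed first and that of the adjoint when
  \<open>x\<close> is, since \<open>x^(2^k)\<close> runs through the whole field.\<close>

lemma card_kernel_adjoint:
  "card {y :: 'a. lin_poly (\<lambda>j. b (k - j) ^ (2 ^ j)) k y = 0} = card {x. lin_poly b k x = 0}"
proof -
  let ?P = "lin_poly (\<lambda>j. b (k - j) ^ (2 ^ j)) k"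
  have "2 ^ n * real (card {x. lin_poly b k x = 0}) =
      (\<Sum>x\<in>UNIV. \<Sum>y\<in>UNIV. chi n (y * lin_poly b k x))"
    by (simp add: sum_chi sum.If_cases)
  also have "\<dots> = (\<Sum>y\<in>UNIV. \<Sum>x\<in>UNIV. chi n (x ^ (2 ^ k) * ?P y))"
    by (subst sum.swap) (intro sum.cong refl chi_adjoint)
  also have "\<dots> = (\<Sum>y\<in>UNIV. \<Sum>x\<in>UNIV. chi n (x * ?P y))"
    by (rule sum.cong[OF refl])
      (rule sum.reindex_bij_betw[OF bij_frob, of "\<lambda>x. chi n (x * ?P _)"])
  also have "\<dots> = 2 ^ n * real (card {y. ?P y = 0})"
    by (simp add: sum_chi sum.If_cases)
  finally show ?thesis by simp
qed

section \<open>Power sums over subspaces and the inverse function\<close>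

interpretation F2: vector_space "F2_scale :: bit \<Rightarrow> 'a \<Rightarrow> 'a"
  by (rule vector_space_F2_scale[OF card])

text \<open>With scalars only 0 and 1, the larger span is the disjoint union of
  \<open>F2.span B\<close> and its translate by \<open>x\<close>.\<close>

lemma sum_span_insert:
  assumes x: "x \<notin> F2.span B"
  shows "(\<Sum>v\<in>F2.span (insert x B). f v) = (\<Sum>v\<in>F2.span B. f v + f (v + x))"
proof -
  have bit: "(\<exists>k :: bit. P k) \<longleftrightarrow> P 0 \<or> P 1" for P by (metis bit_not_zero_iff)
  have "v \<in> F2.span (insert x B) \<longleftrightarrow> v \<in> F2.span B \<or> v \<in> (\<lambda>v. v + x) ` F2.span B" for v
    unfolding F2.span_breakdown_eq bit F2_scale_def by (auto simp: image_iff) (metis diff_add_cancel)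
  then have "F2.span (insert x B) = F2.span B \<union> (\<lambda>v. v + x) ` F2.span B" by blast
  moreover have "F2.span B \<inter> (\<lambda>v. v + x) ` F2.span B = {}"
    using x F2.span_add_eq by fastforce
  ultimately have "(\<Sum>v\<in>F2.span (insert x B). f v) =
      (\<Sum>v\<in>F2.span B. f v) + (\<Sum>v\<in>(\<lambda>v. v + x) ` F2.span B. f v)"
    by (simp add: sum.union_disjoint)
  then show ?thesis by (simp add: sum.reindex sum.distrib)
qed

lemma card_span_independent: "F2.independent B \<Longrightarrow> card (F2.span B) = 2 ^ card B"
proof (induction B rule: finite_induct[OF finite])
  case (2 x B)
  then have "x \<notin> F2.span B" "F2.independent B" by (auto simp: F2.independent_insert)
  with 2 show ?case
    using sum_span_insert[of x B "\<lambda>_. 1 :: nat"] by simp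
qed simp

text \<open>
  Splitting off a basis vector \<open>x\<close> pairs \<open>v\<close> with \<open>v + x\<close>; the top terms cancel in characteristic 2
  and every remaining product over \<open>v\<close> has fewer factors.
\<close>

lemma power_sum_span_eq_0:
  "F2.independent B \<Longrightarrow> finite J \<Longrightarrow> card J < card B \<Longrightarrow> (\<Sum>v\<in>F2.span B. \<Prod>i\<in>J. v ^ (2 ^ i)) = 0"
proof (induction B arbitrary: J rule: finite_induct[OF finite])
  case (2 x B)
  let ?f = "\<lambda>J (v :: 'a). \<Prod>i\<in>J. v ^ (2 ^ i)"
  from 2 have x: "x \<notin> F2.span B" and B: "F2.independent B" by (auto simp: F2.independent_insert)
  have "?f J v + ?f J (v + x) = (\<Sum>K\<in>Pow J - {J}. ?f K v * ?f (J - K) x)" for v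
  proof -
    have "?f J (v + x) = (\<Sum>K\<in>Pow J. ?f K v * ?f (J - K) x)"
      using 2 by (simp add: frob_add prod_add)
    also have "\<dots> = ?f J v + (\<Sum>K\<in>Pow J - {J}. ?f K v * ?f (J - K) x)"
      using 2 by (subst sum.remove[of _ J]) auto
    finally show ?thesis using add_self[of "?f J v"] by (simp flip: add.assoc)
  qed
  then have "(\<Sum>v\<in>F2.span (insert x B). ?f J v) =
      (\<Sum>v\<in>F2.span B. \<Sum>K\<in>Pow J - {J}. ?f K v * ?f (J - K) x)"
    by (simp add: sum_span_insert[OF x])
  also have "\<dots> = (\<Sum>K\<in>Pow J - {J}. (\<Sum>v\<in>F2.span B. ?f K v) * ?f (J - K) x)"
    by (subst sum.swap) (simp add: sum_distrib_right)
  also have "\<dots> = 0"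
  proof (intro sum.neutral ballI)
    fix K assume K: "K \<in> Pow J - {J}"
    then have "finite K" "card K < card J"
      using \<open>finite J\<close> by (auto intro: finite_subset psubset_card_mono)
    moreover have "card J \<le> card B" using 2 by simp
    ultimately have "(\<Sum>v\<in>F2.span B. ?f K v) = 0" using 2(3) B by auto
    then show "(\<Sum>v\<in>F2.span B. ?f K v) * ?f (J - K) x = 0" by simp
  qed
  finally show ?case .
qed simp

text \<open>The binary expansion of the exponent \<open>2^j - 2\<close>.\<close>

lemma sum_powers_2: "1 \<le> j \<Longrightarrow> (\<Sum>i\<in>{1..<j}. 2 ^ i) + 2 = (2 :: nat) ^ j"
  by (induction j rule: dec_induct) auto

text \<open>The adjoint has \<open>c 1 = b (k - 1)^2 = 0\<close>, so on its kernel \<open>V\<close>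
  the element \<open>v\<close> equals the sum of \<open>c j * v^(2^j)\<close> over
  \<open>j \<ge> 2\<close>, and division by \<open>v^2\<close> gives \<open>1 / v\<close>.\<close>

lemma not_sum_free_of_gap:
  fixes b :: "nat \<Rightarrow> 'a"
  assumes b: "splits_with_degree b k" and gap: "b (k - 1) = 0" and k: "k \<ge> 1" and n: "n \<ge> 2"
  shows "\<not> sum_free k (F_inv n :: 'a \<Rightarrow> 'a)"
proof -
  define c where "c = (\<lambda>j. b (k - j) ^ (2 ^ j))"
  define V where "V = {y. lin_poly c k y = 0}"
  have c01: "c 0 = 1" "c 1 = 0" using b gap by (auto simp: c_def splits_with_degree_def)
  have cV: "card V = 2 ^ k"
    using b by (simp add: V_def c_def card_kernel_adjoint splits_with_degree_def)
  have sub: "F2.subspace V"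
  proof (rule F2.subspaceI)
    fix a :: bit and x assume "x \<in> V"
    then show "F2_scale a x \<in> V" by (cases a) (simp_all add: F2_scale_def V_def lin_poly_0)
  qed (simp_all add: V_def lin_poly_0 lin_poly_add)
  obtain B where B: "B \<subseteq> V" "F2.independent B" "V \<subseteq> F2.span B" "card B = F2.dim V"
    by (rule F2.basis_exists)
  then have V: "V = F2.span B" using F2.span_minimal[OF _ sub] by blast
  then have "(2 :: nat) ^ card B = 2 ^ k" using card_span_independent[OF B(2)] cV by simp
  then have cB: "card B = k" by simp
  have inv: "F_inv n v = (\<Sum>j\<in>{2..k}. c j * (\<Prod>i\<in>{1..<j}. v ^ (2 ^ i)))" if "v \<in> V" for v
  proof (cases "v = 0")
    case True
    \<comment> \<open>A positive exponent gives \<open>F_inv n 0 = 0\<close>; on the right each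
      product is nonempty because \<open>j \<ge> 2\<close>.\<close>
    moreover have "(2 :: nat) ^ n - 2 > 0" using power_increasing[OF n, of "2 :: nat"] by simp
    ultimately show ?thesis by (auto simp: F_inv_def power_0_left intro!: sum.neutral)
  next
    case False
    have "(\<Prod>i\<in>{1..<j}. v ^ (2 ^ i)) * v\<^sup>2 = v ^ (2 ^ j)" if "j \<ge> 1" for j
      unfolding sum_powers_2[OF that, symmetric] by (simp only: power_sum power_add)
    then have "(\<Sum>j\<in>{2..k}. c j * (\<Prod>i\<in>{1..<j}. v ^ (2 ^ i))) * v\<^sup>2 = (\<Sum>j\<in>{2..k}. c j * v ^ (2 ^ j))"
      by (simp add: sum_distrib_right mult.assoc)
    also have "\<dots> = v + lin_poly c k v"
    proof -
      have "{..k} = {0, 1} \<union> {2..k}" using k by auto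
      then have "lin_poly c k v = v + (\<Sum>j\<in>{2..k}. c j * v ^ (2 ^ j))"
        using c01 by (simp add: lin_poly_def)
      then show ?thesis using add_self[of v] by (simp flip: add.assoc)
    qed
    also have "\<dots> = F_inv n v * v\<^sup>2"
    proof -
      have "(2 :: nat) ^ n - 2 + 2 = 2 ^ n" using power_increasing[OF n, of "2 :: nat"] by simp
      then have "F_inv n v * v\<^sup>2 = v" by (simp add: F_inv_def frob_n flip: power_add)
      then show ?thesis using that by (simp add: V_def)
    qed
    finally show ?thesis using False by simp
  qed
  have "(\<Sum>v\<in>V. F_inv n v) = (\<Sum>j\<in>{2..k}. c j * (\<Sum>v\<in>V. \<Prod>i\<in>{1..<j}. v ^ (2 ^ i)))"
    by (simp add: inv sum_distrib_left sum.swap[of _ "{2..k}" V])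
  also have "\<dots> = 0"
    \<comment> \<open>Each product has \<open>j - 1 < k\<close> factors.\<close>
    using B(2) cB by (intro sum.neutral) (auto simp: V power_sum_span_eq_0)
  finally have "(\<Sum>v\<in>V. F_inv n v) = 0" .
  moreover have "F2_affine_subspace k V"
    unfolding F2_affine_subspace_def using sub B(4) cB by (intro exI[of _ 0] exI[of _ V]) simp
  ultimately show ?thesis unfolding sum_free_def by blast
qed

end

theorem theorem4p2:
  fixes n k :: nat
  assumes "CARD('a::finite_field) = 2 ^ n"
    and "k \<ge> 3"
    and "real n \<ge> log 2 (1 + sqrt 21) / 3 * (13 * real k - 6)"
  shows "\<not> sum_free k (F_inv n :: 'a \<Rightarrow> 'a)"
proof -
  \<comment> \<open>The logarithm is thus at least 2, so \<open>3 * n \<ge> 26 * k - 12\<close>,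
    which implies \<open>n \<ge> 8 * k - 4 = 8 * (k - 3) + 20\<close>.\<close>
  have "sqrt 21 \<ge> 3" by (rule real_le_rsqrt) simp
  then have "log 2 (1 + sqrt 21) \<ge> 2" by (subst le_log_iff) auto
  then have "log 2 (1 + sqrt 21) / 3 * (13 * real k - 6) \<ge> 2 / 3 * (13 * real k - 6)"
    using assms(2) by (intro mult_right_mono divide_right_mono) auto
  then have "3 * real n \<ge> 26 * real k - 12" using assms(3) by simp
  then have "8 * (k - 3) + 20 \<le> n" using assms(2) by linarith
  then obtain b :: "nat \<Rightarrow> 'a" where "splits_with_degree b (k - 3 + 3)" "b (k - 3 + 2) = 0"
    using exists_splits_with_degree_gap[OF assms(1)] by blast
  moreover have "k - 3 + 3 = k" "k - 3 + 2 = k - 1" using assms(2) by auto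
  ultimately show ?thesis
    using not_sum_free_of_gap[OF assms(1), of b k] assms(2) \<open>8 * (k - 3) + 20 \<le> n\<close> by simp
qed

end
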